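(* Let $\mathcal{A}\in\mathbb{C}^{I(N)\times I(N)}$ be a core tensor. Then the following hold: (a) $\mathcal{A}^{\mathrm{core}}=\mathcal{A}^{\#}*_N\mathcal{A}*_N\mathcal{A}^{\dagger}=\mathcal{A}^{\#}*_N P_{\mathcal{R}(\mathcal{A})}=\mathcal{A}*_N\mathcal{A}^{\#}*_N\mathcal{A}^{\dagger}$; (b) $\mathcal{A}^n*_N\mathcal{A}^{\mathrm{core}}=\mathcal{A}^n*_N\mathcal{A}^{\dagger}$ for every integer $n\ge 1$; (c) $(\mathcal{A}^{\mathrm{core}})^{\dagger}=\mathcal{A}^2*_N\mathcal{A}^{\dagger}=\mathcal{A}^2*_N\mathcal{A}^{\mathrm{core}}$; (d) $\mathcal{A}^{\mathrm{core}}$ is EP; (e) $(\mathcal{A}^{\mathrm{core}})^{\mathrm{core}}=\mathcal{A}^2*_N\mathcal{A}^{\dagger}$; (f) $(\mathcal{A}^{\mathrm{core}})^2*_N\mathcal{A}=\mathcal{A}^{\#}$; (g) $\mathcal{A}^{\mathrm{core}}*_N\mathcal{A}=\mathcal{A}^{\#}*_N\mathcal{A}$.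
   Context: Let $I_1,\dots,I_N$ be positive integers. $\mathbb{C}^{I(N)\times I(N)}$ denotes the set of complex tensors of order $2N$ with entries $\mathcal{A}_{i_1\dots i_N j_1\dots j_N}$, where $1\le i_k,j_k\le I_k$. The Einstein product is $(\mathcal{A}*_N\mathcal{B})_{i_1\dots i_N j_1\dots j_N}=\sum_{k_1,\dots,k_N}\mathcal{A}_{i_1\dots i_N k_1\dots k_N}\mathcal{B}_{k_1\dots k_N j_1\dots j_N}$, and powers $\mathcal{A}^p$ are taken with respect to $*_N$. The conjugate transpose $\mathcal{A}^*$ is defined by $(\mathcal{A}^* )_{j_1\dots j_N i_1\dots i_N}=\overline{\mathcal{A}_{i_1\dots i_N j_1\dots j_N}}$. The reshaping $\mathrm{rsh}(\mathcal{A})$ is the square matrix of size $I_1\cdots I_N$ obtained by listing the row multi-indices $(i_1,\dots,i_N)$ and the column multi-indices $(j_1,\dots,j_N)$ in the column-major order of Matlab's reshape; $\mathrm{rshrank}(\mathcal{A})$ is the rank of $\mathrm{rsh}(\mathcal{A})$. $\mathcal{A}$ is a core tensor if $\mathrm{rshrank}(\mathcal{A})=\mathrm{rshrank}(\mathcal{A}^2)$. The Moore-Penrose inverse $\mathcal{A}^{\dagger}$ is the unique $\mathcal{X}$ with $\mathcal{A}*_N\mathcal{X}*_N\mathcal{A}=\mathcal{A}$, $\mathcal{X}*_N\mathcal{A}*_N\mathcal{X}=\mathcal{X}$, $(\mathcal{A}*_N\mathcal{X})^*=\mathcal{A}*_N\mathcal{X}$, $(\mathcal{X}*_N\mathcal{A})^*=\mathcal{X}*_N\mathcal{A}$.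 The group inverse $\mathcal{A}^{\#}$ of a core tensor is the unique $\mathcal{X}$ with $\mathcal{A}*_N\mathcal{X}*_N\mathcal{A}=\mathcal{A}$, $\mathcal{X}*_N\mathcal{A}*_N\mathcal{X}=\mathcal{X}$, $\mathcal{A}*_N\mathcal{X}=\mathcal{X}*_N\mathcal{A}$. The core inverse $\mathcal{A}^{\mathrm{core}}$ of a core tensor is the unique $\mathcal{X}$ with $\mathcal{X}*_N\mathcal{A}^2=\mathcal{A}$, $\mathcal{A}*_N\mathcal{X}^2=\mathcal{X}$, $(\mathcal{A}*_N\mathcal{X})^*=\mathcal{A}*_N\mathcal{X}$. $P_{\mathcal{R}(\mathcal{A})}=\mathcal{A}*_N\mathcal{A}^{\dagger}$. A tensor $\mathcal{B}$ is EP if $\mathcal{B}*_N\mathcal{B}^{\dagger}=\mathcal{B}^{\dagger}*_N\mathcal{B}$. *)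

theory Defs
  imports "HOL-Library.FuncSet" "Jordan_Normal_Form.DL_Rank"
begin

(* A tensor of order 2N is a function of its row multi-index and its column multi-index.
   Multi-indices are 1-based: the k-th index ranges over {1..I k} for k in {1..N}. *)

type_synonym tensor = "(nat \<Rightarrow> nat) \<Rightarrow> (nat \<Rightarrow> nat) \<Rightarrow> complex"

definition multi_indices :: "nat \<Rightarrow> (nat \<Rightarrow> nat) \<Rightarrow> (nat \<Rightarrow> nat) set" where
  "multi_indices N I = (\<Pi>\<^sub>E k\<in>{1..N}. {1..I k})"

(* Tensors and the operations on them are extensional (undefined outside the index set), so
   that HOL equality of elements of this carrier is entrywise equality. *)
definition tensors :: "nat \<Rightarrow> (nat \<Rightarrow> nat) \<Rightarrow> tensor set" where
  "tensors N I = multi_indices N I \<rightarrow>\<^sub>E multi_indices N I \<rightarrow>\<^sub>E UNIV"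

definition einstein_prod :: "tensor \<Rightarrow> nat \<Rightarrow> (nat \<Rightarrow> nat) \<Rightarrow> tensor \<Rightarrow> tensor"
    (\<open>(_ \<star>\<^bsub>_,_\<^esub> _)\<close> [70, 0, 0, 71] 70) where
  "A \<star>\<^bsub>N,I\<^esub> B = (\<lambda>i\<in>multi_indices N I. \<lambda>j\<in>multi_indices N I.
     \<Sum>k\<in>multi_indices N I. A i k * B k j)"

definition unit_tensor :: "nat \<Rightarrow> (nat \<Rightarrow> nat) \<Rightarrow> tensor" where
  "unit_tensor N I = (\<lambda>i\<in>multi_indices N I. \<lambda>j\<in>multi_indices N I. if i = j then 1 else 0)"

primrec tensor_pow :: "nat \<Rightarrow> (nat \<Rightarrow> nat) \<Rightarrow> tensor \<Rightarrow> nat \<Rightarrow> tensor" where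
  "tensor_pow N I A 0 = unit_tensor N I"
| "tensor_pow N I A (Suc p) = tensor_pow N I A p \<star>\<^bsub>N,I\<^esub> A"

definition conj_transpose :: "nat \<Rightarrow> (nat \<Rightarrow> nat) \<Rightarrow> tensor \<Rightarrow> tensor" where
  "conj_transpose N I A = (\<lambda>j\<in>multi_indices N I. \<lambda>i\<in>multi_indices N I. cnj (A i j))"

(* The multi-index at the 0-based position r of the column-major listing (first index fastest);
   the two lemmas below confirm that it inverts the usual linear index. *)
definition multi_index_at :: "nat \<Rightarrow> (nat \<Rightarrow> nat) \<Rightarrow> nat \<Rightarrow> (nat \<Rightarrow> nat)" where
  "multi_index_at N I r = (\<lambda>k\<in>{1..N}. 1 + (r div (\<Prod>l\<in>{1..<k}. I l)) mod I k)"

lemma multi_index_at_in: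
  assumes "\<forall>k\<in>{1..N}. I k > 0"
  shows "multi_index_at N I r \<in> multi_indices N I"
  using assms by (auto simp: multi_index_at_def multi_indices_def Suc_le_eq)

lemma linear_index_multi_index_at:
  assumes "r < (\<Prod>k\<in>{1..N}. I k)"
  shows "(\<Sum>k\<in>{1..N}. (multi_index_at N I r k - 1) * (\<Prod>l\<in>{1..<k}. I l)) = r"
proof -
  have "(\<Sum>k\<in>{1..M}. (r div (\<Prod>l\<in>{1..<k}. I l)) mod I k * (\<Prod>l\<in>{1..<k}. I l))
      = r mod (\<Prod>k\<in>{1..M}. I k)" for M
  proof (induction M)
    case (Suc M)
    have "{Suc 0..<Suc M} = {Suc 0..M}"
      by auto
    with Suc show ?case
      using mod_mult2_eq[of r "\<Prod>k\<in>{1..M}. I k" "I (Suc M)"]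
      by (simp add: algebra_simps)
  qed simp
  then show ?thesis
    using assms by (simp add: multi_index_at_def)
qed

definition rsh :: "nat \<Rightarrow> (nat \<Rightarrow> nat) \<Rightarrow> tensor \<Rightarrow> complex mat" where
  "rsh N I A = mat (\<Prod>k\<in>{1..N}. I k) (\<Prod>k\<in>{1..N}. I k)
     (\<lambda>(r, c). A (multi_index_at N I r) (multi_index_at N I c))"

definition rshrank :: "nat \<Rightarrow> (nat \<Rightarrow> nat) \<Rightarrow> tensor \<Rightarrow> nat" where
  "rshrank N I A = vec_space.rank (\<Prod>k\<in>{1..N}. I k) (rsh N I A)"

definition core_tensor :: "nat \<Rightarrow> (nat \<Rightarrow> nat) \<Rightarrow> tensor \<Rightarrow> bool" where
  "core_tensor N I A \<longleftrightarrow> A \<in> tensors N I \<and> rshrank N I A = rshrank N I (tensor_pow N I A 2)"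

definition mp_inverse :: "nat \<Rightarrow> (nat \<Rightarrow> nat) \<Rightarrow> tensor \<Rightarrow> tensor" where
  "mp_inverse N I A = (THE X. X \<in> tensors N I \<and>
     A \<star>\<^bsub>N,I\<^esub> X \<star>\<^bsub>N,I\<^esub> A = A \<and>
     X \<star>\<^bsub>N,I\<^esub> A \<star>\<^bsub>N,I\<^esub> X = X \<and>
     conj_transpose N I (A \<star>\<^bsub>N,I\<^esub> X) = A \<star>\<^bsub>N,I\<^esub> X \<and>
     conj_transpose N I (X \<star>\<^bsub>N,I\<^esub> A) = X \<star>\<^bsub>N,I\<^esub> A)"

(* The group and core inverses are meaningful only for core tensors; for other tensors no X
   satisfies the conditions and the description is unspecified. *)
definition group_inverse :: "nat \<Rightarrow> (nat \<Rightarrow> nat) \<Rightarrow> tensor \<Rightarrow> tensor" where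
  "group_inverse N I A = (THE X. X \<in> tensors N I \<and>
     A \<star>\<^bsub>N,I\<^esub> X \<star>\<^bsub>N,I\<^esub> A = A \<and>
     X \<star>\<^bsub>N,I\<^esub> A \<star>\<^bsub>N,I\<^esub> X = X \<and>
     A \<star>\<^bsub>N,I\<^esub> X = X \<star>\<^bsub>N,I\<^esub> A)"

definition core_inverse :: "nat \<Rightarrow> (nat \<Rightarrow> nat) \<Rightarrow> tensor \<Rightarrow> tensor" where
  "core_inverse N I A = (THE X. X \<in> tensors N I \<and>
     X \<star>\<^bsub>N,I\<^esub> tensor_pow N I A 2 = A \<and>
     A \<star>\<^bsub>N,I\<^esub> tensor_pow N I X 2 = X \<and>
     conj_transpose N I (A \<star>\<^bsub>N,I\<^esub> X) = A \<star>\<^bsub>N,I\<^esub> X)"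

definition range_projector :: "nat \<Rightarrow> (nat \<Rightarrow> nat) \<Rightarrow> tensor \<Rightarrow> tensor" where
  "range_projector N I A = A \<star>\<^bsub>N,I\<^esub> mp_inverse N I A"

definition EP_tensor :: "nat \<Rightarrow> (nat \<Rightarrow> nat) \<Rightarrow> tensor \<Rightarrow> bool" where
  "EP_tensor N I B \<longleftrightarrow> B \<in> tensors N I \<and>
     B \<star>\<^bsub>N,I\<^esub> mp_inverse N I B = mp_inverse N I B \<star>\<^bsub>N,I\<^esub> B"

end

theory Submission
  imports Defs "Jordan_Normal_Form.Matrix_Kernel"
begin

text \<open>
  Write \<open>A*\<close>, \<open>G\<close>, \<open>P\<close>, \<open>K\<close> for the conjugate transpose and the group, Moore-Penrose and core inverses of \<open>A\<close>.
  All identities are formal consequences of \<open>K = G A P\<close> and hold in any monoid with involution,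
  since each inverse is determined by its defining equations. The existence of \<open>G\<close> and \<open>P\<close> uses linear
  algebra. If \<open>A\<close> and \<open>A\<^sup>2\<close> have equal rank, they have the same range and the same kernel, so
  \<open>A = A\<^sup>2 Y\<close> for some \<open>Y\<close>, \<open>A\<close> can be cancelled from \<open>A\<^sup>2 S = A\<^sup>2 T\<close>, and \<open>G = A Y Y\<close>. The tensor
  \<open>H = A* A\<close> always has this property because \<open>A* A S = A* A T\<close> implies \<open>A S = A T\<close>; if
  \<open>Q\<close> is the group inverse of \<open>H\<close>, then \<open>P = Q A*\<close>.
\<close>

section \<open>Generalized inverses in a monoid with involution\<close>

text \<open>The carrier is explicit because tensors form a proper part of their function type: the
  unit laws and \<open>star_star\<close> need extensional functions.\<close>

locale star_monoid =
  fixes C :: "'a set" and mult :: "'a \<Rightarrow> 'a \<Rightarrow> 'a" (infixl "\<cdot>" 70)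
    and e :: 'a and star :: "'a \<Rightarrow> 'a"
  assumes closed [simp, intro]: "x \<in> C \<Longrightarrow> y \<in> C \<Longrightarrow> x \<cdot> y \<in> C"
    and assoc: "x \<in> C \<Longrightarrow> y \<in> C \<Longrightarrow> z \<in> C \<Longrightarrow> x \<cdot> y \<cdot> z = x \<cdot> (y \<cdot> z)"
    and unit_closed [simp, intro]: "e \<in> C"
    and unit_left [simp]: "x \<in> C \<Longrightarrow> e \<cdot> x = x"
    and unit_right [simp]: "x \<in> C \<Longrightarrow> x \<cdot> e = x"
    and star_closed [simp, intro]: "x \<in> C \<Longrightarrow> star x \<in> C"
    and star_star [simp]: "x \<in> C \<Longrightarrow> star (star x) = x"
    and star_mult: "x \<in> C \<Longrightarrow> y \<in> C \<Longrightarrow> star (x \<cdot> y) = star y \<cdot> star x"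
begin

section \<open>Uniqueness of the three generalized inverses\<close>

definition mp_inv :: "'a \<Rightarrow> 'a \<Rightarrow> bool" where
  "mp_inv a x \<longleftrightarrow> x \<in> C \<and> a \<cdot> x \<cdot> a = a \<and> x \<cdot> a \<cdot> x = x \<and>
     star (a \<cdot> x) = a \<cdot> x \<and> star (x \<cdot> a) = x \<cdot> a"

definition group_inv :: "'a \<Rightarrow> 'a \<Rightarrow> bool" where
  "group_inv a x \<longleftrightarrow> x \<in> C \<and> a \<cdot> x \<cdot> a = a \<and> x \<cdot> a \<cdot> x = x \<and> a \<cdot> x = x \<cdot> a"

definition core_inv :: "'a \<Rightarrow> 'a \<Rightarrow> bool" where
  "core_inv a x \<longleftrightarrow> x \<in> C \<and> x \<cdot> (a \<cdot> a) = a \<and> a \<cdot> (x \<cdot> x) = x \<and> star (a \<cdot> x) = a \<cdot> x"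

text \<open>Both products are selfadjoint idempotents with the range of \<open>a\<close>. Hence
  \<open>a x = (a y)(a x)\<close>, and applying \<open>star\<close> reverses the factors, which
  leaves \<open>(a x)(a y) = a y\<close>.\<close>

lemma selfadjoint_idem_eq:
  assumes "a \<in> C" "x \<in> C" "y \<in> C" "a \<cdot> x \<cdot> a = a" "a \<cdot> y \<cdot> a = a"
    and "star (a \<cdot> x) = a \<cdot> x" "star (a \<cdot> y) = a \<cdot> y"
  shows "a \<cdot> x = a \<cdot> y"
proof -
  have "a \<cdot> x = star (a \<cdot> y \<cdot> (a \<cdot> x))"
    using assms by (metis assoc closed)
  also have "\<dots> = a \<cdot> x \<cdot> (a \<cdot> y)"
    using assms by (metis star_mult closed)
  also have "\<dots> = a \<cdot> y"
    using assms by (metis assoc closed)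
  finally show ?thesis .
qed

lemma mp_inv_unique:
  assumes a: "a \<in> C" and x: "mp_inv a x" and y: "mp_inv a y"
  shows "x = y"
proof -
  have C: "x \<in> C" "y \<in> C" using x y by (auto simp: mp_inv_def)
  have l: "a \<cdot> x = a \<cdot> y"
    using a x y by (auto simp: mp_inv_def intro!: selfadjoint_idem_eq)
  \<comment> \<open>The involution turns \<open>x a\<close> into \<open>star a\<close> times
    \<open>star x\<close>, so the lemma just used for \<open>a x\<close> also settles the products
    on the other side.\<close>
  have "star a \<cdot> star x \<cdot> star a = star a" "star a \<cdot> star y \<cdot> star a = star a"
    "star (star a \<cdot> star x) = star a \<cdot> star x" "star (star a \<cdot> star y) = star a \<cdot> star y"
    using a C x y by (metis mp_inv_def star_mult closed assoc)+
  then have "star a \<cdot> star x = star a \<cdot> star y"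
    using a C by (auto intro!: selfadjoint_idem_eq)
  then have r: "x \<cdot> a = y \<cdot> a"
    using a C by (metis star_mult star_star closed)
  have "x = x \<cdot> a \<cdot> x" using x by (simp add: mp_inv_def)
  also have "\<dots> = y \<cdot> (a \<cdot> x)" using a C by (simp add: r assoc)
  also have "\<dots> = y" using a C y by (simp add: l mp_inv_def assoc)
  finally show ?thesis .
qed

lemma group_inv_unique:
  assumes a: "a \<in> C" and x: "group_inv a x" and y: "group_inv a y"
  shows "x = y"
proof -
  have C: "x \<in> C" "y \<in> C" using x y by (auto simp: group_inv_def)
  \<comment> \<open>By commutation, \<open>y a x a\<close> equals \<open>a y a x\<close>, which is
    \<open>a x\<close>, that is \<open>x a\<close>; read directly, it is \<open>y a\<close>.\<close>
  have "x \<cdot> a = y \<cdot> a \<cdot> (x \<cdot> a)"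
    using a C x y by (metis group_inv_def assoc closed)
  also have "\<dots> = y \<cdot> a"
    using a C x y by (metis group_inv_def assoc closed)
  finally have r: "x \<cdot> a = y \<cdot> a" .
  then have "x = y \<cdot> (a \<cdot> x)" using a C x by (metis group_inv_def assoc)
  also have "a \<cdot> x = a \<cdot> y" using r x y by (simp add: group_inv_def)
  also have "y \<cdot> (a \<cdot> y) = y" using a C y by (metis group_inv_def assoc)
  finally show ?thesis .
qed

lemma core_inv_unique:
  assumes a: "a \<in> C" and x: "core_inv a x" and y: "core_inv a y"
  shows "x = y"
proof -
  have C: "x \<in> C" "y \<in> C" using x y by (auto simp: core_inv_def)
  \<comment> \<open>The defining equations of a core inverse do not list \<open>a z a = a\<close>.
    It follows by writing the last \<open>a\<close> as \<open>z a a\<close> and then contracting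
    \<open>a z z\<close> to \<open>z\<close>.\<close>
  have inner: "a \<cdot> z \<cdot> a = a" if "core_inv a z" for z
  proof -
    have z: "z \<in> C" "z \<cdot> (a \<cdot> a) = a" "a \<cdot> (z \<cdot> z) = z"
      using that by (auto simp: core_inv_def)
    have "a \<cdot> z \<cdot> a = a \<cdot> z \<cdot> (z \<cdot> (a \<cdot> a))" by (simp add: z)
    also have "\<dots> = a \<cdot> (z \<cdot> z) \<cdot> (a \<cdot> a)" using a z(1) by (simp add: assoc)
    finally show ?thesis by (simp add: z)
  qed
  have outer: "x \<cdot> (a \<cdot> x) = x"
  proof -
    have "x \<cdot> (a \<cdot> x) = x \<cdot> (a \<cdot> (a \<cdot> (x \<cdot> x)))" using x by (simp add: core_inv_def)
    also have "\<dots> = x \<cdot> (a \<cdot> a) \<cdot> (x \<cdot> x)" using a C by (simp add: assoc)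
    finally show ?thesis using x by (simp add: core_inv_def)
  qed
  have "a \<cdot> x = a \<cdot> y"
    using a x y inner by (auto simp: core_inv_def intro!: selfadjoint_idem_eq)
  then have "x = x \<cdot> (a \<cdot> y)" using outer by simp
  also have "\<dots> = x \<cdot> (a \<cdot> (a \<cdot> (y \<cdot> y)))" using y by (simp add: core_inv_def)
  also have "\<dots> = x \<cdot> (a \<cdot> a) \<cdot> (y \<cdot> y)" using a C by (simp add: assoc)
  also have "\<dots> = y" using x y by (simp add: core_inv_def)
  finally show ?thesis .
qed

section \<open>Existence of group and Moore-Penrose inverses from cancellation\<close>

lemma group_inv_exists:
  assumes a: "a \<in> C" and y: "y \<in> C" "a = a \<cdot> a \<cdot> y"
    and cancel: "\<And>s t. s \<in> C \<Longrightarrow> t \<in> C \<Longrightarrow> a \<cdot> a \<cdot> s = a \<cdot> a \<cdot> t \<Longrightarrow> a \<cdot> s = a \<cdot> t"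
  shows "group_inv a (a \<cdot> y \<cdot> y)"
proof -
  have aay: "a \<cdot> (a \<cdot> y) = a" "\<And>z. z \<in> C \<Longrightarrow> a \<cdot> (a \<cdot> (y \<cdot> z)) = a \<cdot> z"
    using a y by (metis assoc closed)+
  \<comment> \<open>Multiplying \<open>a a y = a\<close> by \<open>a\<close> on the right gives
    \<open>a a (y a) = a a e\<close>, to which cancellation applies.\<close>
  have "a \<cdot> (y \<cdot> a) = a \<cdot> e"
    using a y by (intro cancel) (simp_all add: assoc aay)
  then have aya: "a \<cdot> (y \<cdot> a) = a" "\<And>z. z \<in> C \<Longrightarrow> a \<cdot> (y \<cdot> (a \<cdot> z)) = a \<cdot> z"
    using a y by (simp, metis assoc closed unit_right)
  \<comment> \<open>A second cancellation, from \<open>a a y y a = a y a = a = a a y\<close>. Since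
    also \<open>a a y y = a y\<close>, the element \<open>a y y\<close> commutes with
    \<open>a\<close>.\<close>
  have "a \<cdot> (y \<cdot> (y \<cdot> a)) = a \<cdot> y"
    using a y by (intro cancel) (simp_all add: assoc aay aya)
  then show ?thesis
    using a y(1) by (simp add: group_inv_def assoc aay aya)
qed

lemma mp_inv_exists:
  assumes a: "a \<in> C" and q: "group_inv (star a \<cdot> a) q"
    and cancel: "\<And>s t. s \<in> C \<Longrightarrow> t \<in> C \<Longrightarrow> star a \<cdot> a \<cdot> s = star a \<cdot> a \<cdot> t \<Longrightarrow> a \<cdot> s = a \<cdot> t"
  shows "mp_inv a (q \<cdot> star a)"
proof -
  define h where "h = star a \<cdot> a"
  have h: "h \<in> C" "star h = h" using a by (simp_all add: h_def star_mult)
  have q': "q \<in> C" "h \<cdot> q \<cdot> h = h" "q \<cdot> h \<cdot> q = q" "h \<cdot> q = q \<cdot> h"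
    using q unfolding h_def group_inv_def by blast+
  \<comment> \<open>As \<open>h\<close> is selfadjoint, \<open>star\<close> maps the equations for
    \<open>q\<close> to those for \<open>star q\<close>; uniqueness then makes \<open>q\<close>
    selfadjoint.\<close>
  have "group_inv h (star q)"
    unfolding group_inv_def using q' h by (metis star_mult star_closed closed assoc)
  then have sq: "star q = q"
    using group_inv_unique[OF h(1)] q by (simp add: h_def)
  \<comment> \<open>This is \<open>h q h = h e\<close>. Cancelling the leading \<open>star a\<close>
    yields the first Moore-Penrose equation for \<open>q\<close> times
    \<open>star a\<close>.\<close>
  have "star a \<cdot> a \<cdot> (q \<cdot> h) = star a \<cdot> a \<cdot> e"
    using q'(1,2) h by (simp add: assoc flip: h_def)
  then have "a \<cdot> (q \<cdot> h) = a \<cdot> e"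
    using q'(1) h by (intro cancel) simp_all
  then have "a \<cdot> (q \<cdot> star a) \<cdot> a = a"
    using a q' h by (simp add: h_def assoc)
  moreover have "q \<cdot> star a \<cdot> a \<cdot> (q \<cdot> star a) = q \<cdot> star a"
    using a q'(1,3) h by (metis h_def assoc closed star_closed)
  moreover have "star (q \<cdot> star a \<cdot> a) = q \<cdot> star a \<cdot> a"
    using a q' h sq by (metis h_def assoc star_mult star_closed)
  ultimately show ?thesis
    using a q'(1) sq by (simp add: mp_inv_def star_mult assoc)
qed

section \<open>Identities for the product \<open>g a p\<close>\<close>

context
  fixes a g p
  assumes a [simp]: "a \<in> C" and g: "group_inv a g" and p: "mp_inv a p"
begin

lemma inv_closed: "g \<in> C" "p \<in> C"
  using g p by (auto simp: group_inv_def mp_inv_def)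

text \<open>Oriented for simplification of right-nested products: \<open>g\<close> moves left past
  \<open>a\<close>, and each rule recurs with a trailing factor \<open>z\<close> so that it applies
  inside longer products. The rules \<open>g p a = g\<close> and \<open>a p g = g\<close> hold
  because \<open>g = g g a = a g g\<close> puts a factor \<open>a\<close> next to
  \<open>p\<close>.\<close>

lemma inv_rewrites:
  "a \<cdot> (p \<cdot> a) = a" "z \<in> C \<Longrightarrow> a \<cdot> (p \<cdot> (a \<cdot> z)) = a \<cdot> z"
  "a \<cdot> g = g \<cdot> a" "z \<in> C \<Longrightarrow> a \<cdot> (g \<cdot> z) = g \<cdot> (a \<cdot> z)"
  "g \<cdot> (a \<cdot> a) = a" "z \<in> C \<Longrightarrow> g \<cdot> (a \<cdot> (a \<cdot> z)) = a \<cdot> z"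
  "g \<cdot> (g \<cdot> a) = g" "z \<in> C \<Longrightarrow> g \<cdot> (g \<cdot> (a \<cdot> z)) = g \<cdot> z"
  "g \<cdot> (p \<cdot> a) = g" "z \<in> C \<Longrightarrow> g \<cdot> (p \<cdot> (a \<cdot> z)) = g \<cdot> z"
  "a \<cdot> (p \<cdot> g) = g" "z \<in> C \<Longrightarrow> a \<cdot> (p \<cdot> (g \<cdot> z)) = g \<cdot> z"
proof -
  note G = g[unfolded group_inv_def] and P = p[unfolded mp_inv_def]
  show apa: "a \<cdot> (p \<cdot> a) = a" using P by (simp add: assoc inv_closed)
  then show apaz: "a \<cdot> (p \<cdot> (a \<cdot> z)) = a \<cdot> z" if "z \<in> C" for z using that by (metis assoc closed a inv_closed)
  show ag: "a \<cdot> g = g \<cdot> a" using G by simp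
  then show agz: "a \<cdot> (g \<cdot> z) = g \<cdot> (a \<cdot> z)" if "z \<in> C" for z using that by (metis assoc a inv_closed)
  show gaa: "g \<cdot> (a \<cdot> a) = a" using G by (metis assoc a)
  then show "g \<cdot> (a \<cdot> (a \<cdot> z)) = a \<cdot> z" if "z \<in> C" for z using that by (metis assoc closed a inv_closed)
  show gga: "g \<cdot> (g \<cdot> a) = g" using G by (metis assoc a)
  then show ggaz: "g \<cdot> (g \<cdot> (a \<cdot> z)) = g \<cdot> z" if "z \<in> C" for z using that by (metis assoc closed a inv_closed)
  have "g \<cdot> (p \<cdot> a) = g \<cdot> (g \<cdot> (a \<cdot> (p \<cdot> a)))" using ggaz[of "p \<cdot> a"] by (simp add: inv_closed)
  also have "\<dots> = g" using apa gga by simp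
  finally show gpa: "g \<cdot> (p \<cdot> a) = g" .
  then show "g \<cdot> (p \<cdot> (a \<cdot> z)) = g \<cdot> z" if "z \<in> C" for z using that by (metis assoc closed a inv_closed)
  have "g = a \<cdot> (g \<cdot> g)" using gga agz[of g] ag by (simp add: inv_closed)
  then show apg: "a \<cdot> (p \<cdot> g) = g" using apaz[of "g \<cdot> g"] by (simp add: inv_closed)
  then show "a \<cdot> (p \<cdot> (g \<cdot> z)) = g \<cdot> z" if "z \<in> C" for z using that by (metis assoc closed a inv_closed)
qed

lemma range_proj_selfadjoint: "star (a \<cdot> p) = a \<cdot> p"
  using p by (simp add: mp_inv_def)

lemma core_inv_formula: "core_inv a (g \<cdot> a \<cdot> p)"
  by (simp add: core_inv_def assoc inv_closed inv_rewrites range_proj_selfadjoint)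

lemma mult_core_inv_formula: "a \<cdot> (g \<cdot> a \<cdot> p) = a \<cdot> p"
  by (simp add: assoc inv_closed inv_rewrites)

text \<open>The products of \<open>g a p\<close> and \<open>a a p\<close> in either order reduce to
  \<open>a p\<close>, which is selfadjoint. This one fact yields the Moore-Penrose inverse, the core
  inverse and the EP property of \<open>g a p\<close>.\<close>

lemma mp_inv_core_formula: "mp_inv (g \<cdot> a \<cdot> p) (a \<cdot> a \<cdot> p)"
  by (simp add: mp_inv_def assoc inv_closed inv_rewrites range_proj_selfadjoint)

lemma core_inv_core_formula: "core_inv (g \<cdot> a \<cdot> p) (a \<cdot> a \<cdot> p)"
  by (simp add: core_inv_def assoc inv_closed inv_rewrites range_proj_selfadjoint)

lemma core_formula_commute: "g \<cdot> a \<cdot> p \<cdot> (a \<cdot> a \<cdot> p) = a \<cdot> a \<cdot> p \<cdot> (g \<cdot> a \<cdot> p)"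
  by (simp add: assoc inv_closed inv_rewrites)

lemma core_formula_square: "g \<cdot> a \<cdot> p \<cdot> (g \<cdot> a \<cdot> p) \<cdot> a = g"
  by (simp add: assoc inv_closed inv_rewrites)

lemma core_formula_mult: "g \<cdot> a \<cdot> p \<cdot> a = g \<cdot> a"
  by (simp add: assoc inv_closed inv_rewrites)

end

end

section \<open>Matrices whose square has the same rank\<close>

text \<open>A basis of \<open>X\<close> stays independent in the whole space and has as many
  elements as the dimension, so it spans everything.\<close>

lemma (in vectorspace) subspace_eq_carrier:
  assumes X: "subspace K X V" and fin: "fin_dim" "vectorspace.fin_dim K (vs X)"
    and dim: "vectorspace.dim K (vs X) = dim"
  shows "X = carrier V"
proof -
  interpret X: vectorspace K "vs X"
    using X by (rule subspace_is_vs)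
  have sub: "submodule K X V" and XV: "X \<subseteq> carrier V"
    using X by (auto simp: subspace_def submodule_def)
  obtain b where b: "finite b" "X.basis b"
    using X.finite_basis_exists[OF fin(2)] by blast
  then have bX: "b \<subseteq> X" and "X.lin_indpt b" and gen: "X.span b = X"
    by (auto simp: X.basis_def)
  then have "lin_indpt b"
    using span_li_not_depend(2)[OF bX sub] by simp
  moreover have "card b \<ge> dim"
    using X.dim_basis[OF b] dim by simp
  ultimately have "basis b"
    using dim_li_is_basis[OF fin(1) b(1)] bX XV by auto
  then show ?thesis
    using span_li_not_depend(1)[OF bX sub] gen by (simp add: basis_def)
qed

lemma (in vectorspace) subspace_eq:
  assumes "subspace K X V" "subspace K W V" "X \<subseteq> W"
    and fin: "vectorspace.fin_dim K (vs X)" "vectorspace.fin_dim K (vs W)"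
    and dim: "vectorspace.dim K (vs X) = vectorspace.dim K (vs W)"
  shows "X = W"
proof -
  interpret W: vectorspace K "vs W"
    using assms(2) by (rule subspace_is_vs)
  show ?thesis
    using W.subspace_eq_carrier[OF nested_subspaces[OF assms(2,1,3)] fin(2)] fin(1) dim by simp
qed

section \<open>Rank, kernel and column space of a square matrix\<close>

context vec_space
begin

lemma linear_map_mult_mat_vec:
  assumes A: "A \<in> carrier_mat n n"
  shows "linear_map class_ring V V ((*\<^sub>v) A)"
proof -
  have "(*\<^sub>v) A \<in> LinearCombinations.module_hom class_ring V V"
    using mult_add_distrib_mat_vec[OF A] mult_mat_vec[OF A] A
    by (simp add: LinearCombinations.module_hom_def)
  then have "mod_hom class_ring V V ((*\<^sub>v) A)"
    by (intro mod_hom.intro mod_hom_axioms.intro module_axioms)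
  then show ?thesis
    by (intro linear_map.intro vectorspace_axioms)
qed

lemma subspace_mat_kernel:
  assumes A: "A \<in> carrier_mat n n"
  shows "subspace class_ring (mat_kernel A) V"
proof -
  interpret T: linear_map class_ring V V "(*\<^sub>v) A"
    using A by (rule linear_map_mult_mat_vec)
  have "T.kerT = mat_kernel A"
    using A by (auto simp: T.ker_def mat_kernel)
  then show ?thesis
    using T.kerT_is_subspace by simp
qed

lemma fin_dim_mat_kernel:
  assumes "A \<in> carrier_mat n n"
  shows "vectorspace.fin_dim class_ring (vs (mat_kernel A))"
proof -
  interpret K: kernel n n A
    using assms by unfold_locales
  show ?thesis
    using kernel_basis_exists[OF assms] by (auto simp: K.Ker.basis_def K.Ker.fin_dim_def)
qed

lemma subspace_col_space:
  assumes "A \<in> carrier_mat n n"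
  shows "subspace class_ring (col_space A) V"
  using assms cols_dim[of A] by (auto simp: col_space_def intro!: span_is_subspace)

lemma col_space_mult_subset:
  assumes "A \<in> carrier_mat n n" "B \<in> carrier_mat n n"
  shows "col_space (A * B) \<subseteq> col_space A"
proof -
  have AB: "A * B \<in> carrier_mat n n" using assms by simp
  show ?thesis
    unfolding col_space_eq[OF AB] col_space_eq[OF assms(1)] using assms
    by (auto intro!: bexI[of _ "B *\<^sub>v _"])
qed

lemma rank_nullity_mat:
  assumes A: "A \<in> carrier_mat n n"
  shows "rank A + vectorspace.dim class_ring (vs (mat_kernel A)) = n"
proof -
  interpret T: linear_map class_ring V V "(*\<^sub>v) A"
    using A by (rule linear_map_mult_mat_vec)
  have "T.kerT = mat_kernel A" "T.imT = col_space A"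
    using A by (auto simp: T.ker_def mat_kernel T.im_def col_space_eq)
  then show ?thesis
    using T.rank_nullity[OF fin_dim] by (simp add: rank_def col_space_def dim_is_n)
qed

text \<open>The kernel of \<open>A\<close> always lies in that of \<open>A * A\<close>. By
  rank-nullity, equal ranks mean equal kernel dimensions, and nested subspaces of equal dimension
  coincide.\<close>

lemma rank_square_eq_iff_kernel:
  assumes A: "A \<in> carrier_mat n n"
  shows "rank (A * A) = rank A \<longleftrightarrow> mat_kernel (A * A) = mat_kernel A"
proof -
  have AA: "A * A \<in> carrier_mat n n" using A by simp
  show ?thesis
    using subspace_eq[OF subspace_mat_kernel[OF A] subspace_mat_kernel[OF AA]
        mat_kernel_mult_subset[OF A A] fin_dim_mat_kernel[OF A] fin_dim_mat_kernel[OF AA]]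
      rank_nullity_mat[OF A] rank_nullity_mat[OF AA] by (metis add_right_cancel add_left_cancel)
qed

text \<open>Equal ranks force the column space of \<open>A * A\<close> to fill that of
  \<open>A\<close>. So each column of \<open>A\<close> is \<open>A * A\<close> times some vector,
  and these vectors are the columns of \<open>Y\<close>.\<close>

lemma rank_square_eq_factor:
  assumes A: "A \<in> carrier_mat n n" and rank: "rank (A * A) = rank A"
  obtains Y where "Y \<in> carrier_mat n n" "A = A * A * Y"
proof -
  have AA: "A * A \<in> carrier_mat n n" using A by simp
  have "col_space (A * A) = col_space A"
    using subspace_eq[OF subspace_col_space[OF AA] subspace_col_space[OF A]
        col_space_mult_subset[OF A A]] rank fin_dim_span_cols[OF A] fin_dim_span_cols[OF AA]
    by (simp add: rank_def col_space_def)
  then have "A *\<^sub>v unit_vec n j \<in> col_space (A * A)" for j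
    using A by (auto simp: col_space_eq)
  then have "\<exists>y \<in> carrier_vec n. A * A *\<^sub>v y = A *\<^sub>v unit_vec n j" for j
    using A AA by (auto simp: col_space_eq)
  then obtain y where y: "\<And>j. y j \<in> carrier_vec n" "\<And>j. A * A *\<^sub>v y j = A *\<^sub>v unit_vec n j"
    by metis
  define Y where "Y = mat_of_cols n (map y [0..<n])"
  have Y: "Y \<in> carrier_mat n n" by (auto simp: Y_def)
  have "A = A * A * Y"
  proof (rule mat_col_eqI)
    fix j assume "j < dim_col (A * A * Y)"
    then have j: "j < n" using Y by simp
    have "col (A * A * Y) j = A * A *\<^sub>v col Y j"
      by (rule col_mult2[OF AA Y j])
    also have "col Y j = y j"
      using j y by (auto simp: Y_def)
    also have "A * A *\<^sub>v y j = col A j"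
      using y(2) col_mult2[OF A one_carrier_mat j] A j by simp
    finally show "col A j = col (A * A * Y) j" ..
  qed (use A Y in auto)
  with Y show thesis by (rule that)
qed

text \<open>Both conditions compare the kernels of \<open>A * A\<close> and \<open>A\<close>, column
  by column. The forward direction serves a given core tensor; the converse supplies the rank
  condition for the conjugate transpose of a tensor times that tensor.\<close>

lemma rank_square_eq_iff_cancel:
  assumes A: "A \<in> carrier_mat n n"
  shows "rank (A * A) = rank A \<longleftrightarrow>
    (\<forall>S\<in>carrier_mat n n. \<forall>T\<in>carrier_mat n n. A * A * S = A * A * T \<longrightarrow> A * S = A * T)"
    (is "_ \<longleftrightarrow> ?cancel")
proof
  have AA: "A * A \<in> carrier_mat n n" using A by simp
  assume "rank (A * A) = rank A"
  then have ker: "mat_kernel (A * A) = mat_kernel A"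
    using rank_square_eq_iff_kernel[OF A] by simp
  show ?cancel
  proof (intro ballI impI)
    fix S T :: "'a mat"
    assume S: "S \<in> carrier_mat n n" and T: "T \<in> carrier_mat n n" and eq: "A * A * S = A * A * T"
    show "A * S = A * T"
    proof (rule mat_col_eqI)
      fix j assume "j < dim_col (A * T)"
      then have j: "j < n" using T by simp
      have cS: "col S j \<in> carrier_vec n" "col T j \<in> carrier_vec n" using S T j by auto
      have "A * A *\<^sub>v (col S j - col T j) = col (A * A * S) j - col (A * A * T) j"
        using S T j cS
        by (simp add: mult_minus_distrib_mat_vec[OF AA] col_mult2[OF AA S] col_mult2[OF AA T])
      also have "\<dots> = 0\<^sub>v n"
        using eq A T j by simp
      finally have "col S j - col T j \<in> mat_kernel A"
        using cS by (auto simp: ker[symmetric] intro!: mat_kernelI[OF AA])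
      then have "A *\<^sub>v col S j - A *\<^sub>v col T j = 0\<^sub>v n"
        using mat_kernelD(2)[OF A] mult_minus_distrib_mat_vec[OF A cS] by metis
      then have "(A *\<^sub>v col S j - A *\<^sub>v col T j) $ i = 0" if "i < n" for i
        using that by simp
      then have "A *\<^sub>v col S j = A *\<^sub>v col T j"
        using A by (intro eq_vecI) (simp_all del: index_mult_mat_vec)
      then show "col (A * S) j = col (A * T) j"
        by (simp add: col_mult2[OF A S j] col_mult2[OF A T j])
    qed (use A S T in auto)
  qed
next
  have AA: "A * A \<in> carrier_mat n n" using A by simp
  assume cancel: ?cancel
  have "v \<in> mat_kernel A" if "v \<in> mat_kernel (A * A)" for v
  \<comment> \<open>Column 0 is read off below, so it has to exist.\<close>
  proof (cases "n = 0")
    case True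
    then show ?thesis using that A by (auto simp: mat_kernel_def)
  next
    case False
    have v: "v \<in> carrier_vec n" "A * A *\<^sub>v v = 0\<^sub>v n"
      using mat_kernelD[OF AA that] by auto
    \<comment> \<open>A kernel vector becomes a matrix by repeating it in every column; cancellation
      is then applied to \<open>S\<close> and the zero matrix.\<close>
    define S where "S = mat_of_cols n (map (\<lambda>_. v) [0..<n])"
    have S: "S \<in> carrier_mat n n" by (auto simp: S_def)
    have col: "col S j = v" if "j < n" for j
      using that v by (simp add: S_def)
    have "A * A * S = A * A * 0\<^sub>m n n"
    proof (rule mat_col_eqI)
      fix j assume "j < dim_col (A * A * 0\<^sub>m n n)"
      then have "j < n" by simp
      then show "col (A * A * S) j = col (A * A * 0\<^sub>m n n) j"
        using v by (simp add: col_mult2[OF AA S] col right_mult_zero_mat[OF AA])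
    qed (use A S in auto)
    then have "A * S = A * 0\<^sub>m n n"
      using cancel S zero_carrier_mat by blast
    then have "col (A * S) 0 = 0\<^sub>v n"
      using A False by simp
    then have "A *\<^sub>v v = 0\<^sub>v n"
      using False by (simp add: col_mult2[OF A S] col)
    with v(1) show ?thesis by (intro mat_kernelI[OF A])
  qed
  then show "rank (A * A) = rank A"
    using rank_square_eq_iff_kernel[OF A] mat_kernel_mult_subset[OF A A] by blast
qed

end
section \<open>Tensors under the Einstein product\<close>

lemma finite_multi_indices: "finite (multi_indices N I)"
  by (simp add: multi_indices_def finite_PiE)

lemma einstein_prod_apply:
  "i \<in> multi_indices N I \<Longrightarrow> j \<in> multi_indices N I \<Longrightarrow>
    (A \<star>\<^bsub>N,I\<^esub> B) i j = (\<Sum>k\<in>multi_indices N I. A i k * B k j)"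
  by (simp add: einstein_prod_def)

lemma tensor_eqI:
  assumes "A \<in> tensors N I" "B \<in> tensors N I"
    and "\<And>i j. i \<in> multi_indices N I \<Longrightarrow> j \<in> multi_indices N I \<Longrightarrow> A i j = B i j"
  shows "A = B"
proof (rule PiE_ext)
  show "A \<in> multi_indices N I \<rightarrow>\<^sub>E multi_indices N I \<rightarrow>\<^sub>E UNIV"
    "B \<in> multi_indices N I \<rightarrow>\<^sub>E multi_indices N I \<rightarrow>\<^sub>E UNIV"
    using assms(1,2) by (simp_all add: tensors_def)
  then show "A i = B i" if "i \<in> multi_indices N I" for i
    using that assms(3) by (intro PiE_ext[of "A i" "multi_indices N I" "\<lambda>_. UNIV" "B i"]) auto
qed

lemma einstein_prod_closed: "A \<star>\<^bsub>N,I\<^esub> B \<in> tensors N I"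
  by (auto simp: einstein_prod_def tensors_def)

lemma star_monoid_tensors:
  "star_monoid (tensors N I) (\<lambda>A B. A \<star>\<^bsub>N,I\<^esub> B) (unit_tensor N I) (conj_transpose N I)"
proof
  show "A \<star>\<^bsub>N,I\<^esub> B \<star>\<^bsub>N,I\<^esub> D = A \<star>\<^bsub>N,I\<^esub> (B \<star>\<^bsub>N,I\<^esub> D)" for A B D
  proof (rule tensor_eqI[OF einstein_prod_closed einstein_prod_closed])
    fix i j assume ij: "i \<in> multi_indices N I" "j \<in> multi_indices N I"
    have "(A \<star>\<^bsub>N,I\<^esub> B \<star>\<^bsub>N,I\<^esub> D) i j =
        (\<Sum>k\<in>multi_indices N I. \<Sum>l\<in>multi_indices N I. A i l * B l k * D k j)"
      using ij by (simp add: einstein_prod_apply sum_distrib_right)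
    also have "\<dots> = (\<Sum>l\<in>multi_indices N I. \<Sum>k\<in>multi_indices N I. A i l * B l k * D k j)"
      by (rule sum.swap)
    also have "\<dots> = (A \<star>\<^bsub>N,I\<^esub> (B \<star>\<^bsub>N,I\<^esub> D)) i j"
      using ij by (simp add: einstein_prod_apply sum_distrib_left mult.assoc)
    finally show "(A \<star>\<^bsub>N,I\<^esub> B \<star>\<^bsub>N,I\<^esub> D) i j = (A \<star>\<^bsub>N,I\<^esub> (B \<star>\<^bsub>N,I\<^esub> D)) i j" .
  qed
  show unit: "unit_tensor N I \<in> tensors N I"
    by (auto simp: unit_tensor_def tensors_def)
  show star: "conj_transpose N I A \<in> tensors N I" for A
    by (auto simp: conj_transpose_def tensors_def)
  show "unit_tensor N I \<star>\<^bsub>N,I\<^esub> A = A" "A \<star>\<^bsub>N,I\<^esub> unit_tensor N I = A"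
    if "A \<in> tensors N I" for A
    using that by (auto intro!: tensor_eqI[of _ N I] einstein_prod_closed
        simp: einstein_prod_apply unit_tensor_def finite_multi_indices
          if_distrib[of "\<lambda>x. x * _"] if_distrib[of "(*) _"] cong: if_cong)
  show "conj_transpose N I (conj_transpose N I A) = A" if "A \<in> tensors N I" for A
    using that star by (auto intro!: tensor_eqI[of _ N I] simp: conj_transpose_def)
  show "conj_transpose N I (A \<star>\<^bsub>N,I\<^esub> B) =
      conj_transpose N I B \<star>\<^bsub>N,I\<^esub> conj_transpose N I A" for A B
    by (rule tensor_eqI[OF star einstein_prod_closed])
      (simp add: conj_transpose_def einstein_prod_apply mult.commute)
qed (rule einstein_prod_closed)

text \<open>Each column \<open>w\<close> of \<open>A S - A T\<close> lies in the range of \<open>A\<close> and in the kernel of its adjoint, so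
  \<open>w\<close> is orthogonal to itself.\<close>
lemma einstein_prod_cancel_conj_transpose:
  assumes eq: "conj_transpose N I A \<star>\<^bsub>N,I\<^esub> (A \<star>\<^bsub>N,I\<^esub> S) = conj_transpose N I A \<star>\<^bsub>N,I\<^esub> (A \<star>\<^bsub>N,I\<^esub> T)"
  shows "A \<star>\<^bsub>N,I\<^esub> S = A \<star>\<^bsub>N,I\<^esub> T"
proof (rule tensor_eqI[OF einstein_prod_closed einstein_prod_closed])
  let ?M = "multi_indices N I"
  fix i j assume i: "i \<in> ?M" and j: "j \<in> ?M"
  \<comment> \<open>For fixed \<open>j\<close>, \<open>d\<close> and \<open>w\<close> are column
    \<open>j\<close> of S - T and of A S - A T, so \<open>w\<close> is \<open>A\<close> applied to
    \<open>d\<close>.\<close>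
  define d where "d k = S k j - T k j" for k
  define w where "w i = (A \<star>\<^bsub>N,I\<^esub> S) i j - (A \<star>\<^bsub>N,I\<^esub> T) i j" for i
  have w: "w i = (\<Sum>k\<in>?M. A i k * d k)" if "i \<in> ?M" for i
    using that j by (simp add: w_def d_def einstein_prod_apply right_diff_distrib sum_subtractf)
  have orth: "(\<Sum>i\<in>?M. cnj (A i l) * w i) = 0" if "l \<in> ?M" for l
    using arg_cong[OF eq, of "\<lambda>X. X l j"] that j
    by (simp add: einstein_prod_apply[of l N I j "conj_transpose N I A"] w_def
        right_diff_distrib sum_subtractf) (simp add: conj_transpose_def)
  have "(\<Sum>i\<in>?M. w i * cnj (w i)) = (\<Sum>i\<in>?M. \<Sum>k\<in>?M. cnj (d k) * (cnj (A i k) * w i))"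
    by (intro sum.cong refl) (simp add: w sum_distrib_left mult_ac)
  also have "\<dots> = (\<Sum>k\<in>?M. \<Sum>i\<in>?M. cnj (d k) * (cnj (A i k) * w i))"
    by (rule sum.swap)
  also have "\<dots> = 0"
    by (simp add: orth flip: sum_distrib_left)
  finally have "of_real (\<Sum>i\<in>?M. (cmod (w i))\<^sup>2) = (0 :: complex)"
    by (simp add: complex_norm_square del: of_real_power)
  then have "(\<Sum>i\<in>?M. (cmod (w i))\<^sup>2) = 0"
    by (simp only: of_real_eq_0_iff)
  then have "w i = 0"
    using i by (simp add: sum_nonneg_eq_0_iff finite_multi_indices)
  then show "(A \<star>\<^bsub>N,I\<^esub> S) i j = (A \<star>\<^bsub>N,I\<^esub> T) i j"
    by (simp add: w_def)
qed

section \<open>Reshaping as a multiplicative bijection onto square matrices\<close>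

lemma bij_betw_multi_index_at:
  assumes "\<forall>k\<in>{1..N}. I k > 0"
  shows "bij_betw (multi_index_at N I) {0..<\<Prod>k\<in>{1..N}. I k} (multi_indices N I)"
proof -
  let ?n = "\<Prod>k\<in>{1..N}. I k"
  \<comment> \<open>The linear index is a left inverse; surjectivity then follows by
    counting.\<close>
  have inj: "inj_on (multi_index_at N I) {0..<?n}"
    by (rule inj_on_inverseI[where g = "\<lambda>i. \<Sum>k\<in>{1..N}. (i k - 1) * (\<Prod>l\<in>{1..<k}. I l)"])
      (simp only: atLeastLessThan_iff linear_index_multi_index_at)
  moreover have "multi_index_at N I ` {0..<?n} = multi_indices N I"
  proof (rule card_subset_eq[OF finite_multi_indices])
    show "multi_index_at N I ` {0..<?n} \<subseteq> multi_indices N I"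
      using multi_index_at_in[OF assms] by auto
    show "card (multi_index_at N I ` {0..<?n}) = card (multi_indices N I)"
      using inj by (simp add: card_image multi_indices_def card_PiE)
  qed
  ultimately show ?thesis by (simp add: bij_betw_def)
qed

context
  fixes N :: nat and I :: "nat \<Rightarrow> nat" and n :: nat
  assumes pos: "\<forall>k\<in>{1..N}. I k > 0"
  defines "n \<equiv> \<Prod>k\<in>{1..N}. I k"
begin

interpretation T: star_monoid "tensors N I" "\<lambda>A B. A \<star>\<^bsub>N,I\<^esub> B" "unit_tensor N I" "conj_transpose N I"
  by (rule star_monoid_tensors)

lemma rsh_carrier [simp]: "rsh N I A \<in> carrier_mat n n"
  by (simp add: rsh_def n_def)

lemma rsh_index [simp]:
  "r < n \<Longrightarrow> c < n \<Longrightarrow> rsh N I A $$ (r, c) = A (multi_index_at N I r) (multi_index_at N I c)"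
  by (simp add: rsh_def n_def)

lemma dim_rsh [simp]: "dim_row (rsh N I A) = n" "dim_col (rsh N I A) = n"
  by (simp_all add: rsh_def n_def)

lemma rshrank_eq: "rshrank N I A = vec_space.rank n (rsh N I A)"
  unfolding rshrank_def n_def ..

lemma bij_betw_positions: "bij_betw (multi_index_at N I) {0..<n} (multi_indices N I)"
  unfolding n_def by (rule bij_betw_multi_index_at[OF pos])

lemma rsh_einstein_prod: "rsh N I (A \<star>\<^bsub>N,I\<^esub> B) = rsh N I A * rsh N I B"
proof (rule eq_matI)
  fix r c assume "r < dim_row (rsh N I A * rsh N I B)" "c < dim_col (rsh N I A * rsh N I B)"
  then have rc: "r < n" "c < n" by simp_all
  let ?m = "multi_index_at N I"
  have "rsh N I (A \<star>\<^bsub>N,I\<^esub> B) $$ (r, c) = (\<Sum>k\<in>multi_indices N I. A (?m r) k * B k (?m c))"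
    using rc multi_index_at_in[OF pos] by (simp add: einstein_prod_apply)
  \<comment> \<open>Only bijectivity of the listing enters: it reindexes the sum over multi-indices
    by matrix positions.\<close>
  also have "\<dots> = (\<Sum>s\<in>{0..<n}. A (?m r) (?m s) * B (?m s) (?m c))"
    by (rule sum.reindex_bij_betw[OF bij_betw_positions, symmetric])
  also have "\<dots> = (rsh N I A * rsh N I B) $$ (r, c)"
    using rc by (simp add: scalar_prod_def)
  finally show "rsh N I (A \<star>\<^bsub>N,I\<^esub> B) $$ (r, c) = (rsh N I A * rsh N I B) $$ (r, c)" .
qed simp_all

lemma rsh_eq_iff:
  assumes "A \<in> tensors N I" "B \<in> tensors N I"
  shows "rsh N I A = rsh N I B \<longleftrightarrow> A = B"
proof
  assume eq: "rsh N I A = rsh N I B"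
  show "A = B"
  proof (rule tensor_eqI[OF assms])
    fix i j assume "i \<in> multi_indices N I" "j \<in> multi_indices N I"
    then obtain r c where rc: "r < n" "c < n" "i = multi_index_at N I r" "j = multi_index_at N I c"
      using bij_betw_imp_surj_on[OF bij_betw_positions] by (metis atLeastLessThan_iff imageE)
    then show "A i j = B i j"
      using arg_cong[OF eq, of "\<lambda>M. M $$ (r, c)"] by simp
  qed
qed simp

lemma rsh_surj:
  assumes M: "M \<in> carrier_mat n n"
  obtains A where "A \<in> tensors N I" "rsh N I A = M"
proof
  let ?pos = "the_inv_into {0..<n} (multi_index_at N I)"
  let ?A = "\<lambda>i\<in>multi_indices N I. \<lambda>j\<in>multi_indices N I. M $$ (?pos i, ?pos j)"
  show "?A \<in> tensors N I" by (auto simp: tensors_def)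
  have "?pos (multi_index_at N I r) = r" if "r < n" for r
    using that bij_betw_imp_inj_on[OF bij_betw_positions] by (intro the_inv_into_f_f) simp_all
  then show "rsh N I ?A = M"
    using M multi_index_at_in[OF pos] by (intro eq_matI) auto
qed

lemma rshrank_square_eq_iff_cancel:
  "rshrank N I (A \<star>\<^bsub>N,I\<^esub> A) = rshrank N I A \<longleftrightarrow>
    (\<forall>S\<in>tensors N I. \<forall>T\<in>tensors N I.
      A \<star>\<^bsub>N,I\<^esub> A \<star>\<^bsub>N,I\<^esub> S = A \<star>\<^bsub>N,I\<^esub> A \<star>\<^bsub>N,I\<^esub> T \<longrightarrow> A \<star>\<^bsub>N,I\<^esub> S = A \<star>\<^bsub>N,I\<^esub> T)"
proof -
  let ?R = "rsh N I A"
  \<comment> \<open>Since \<open>rsh\<close> is onto, quantification over matrices becomes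
    quantification over reshaped tensors, and injectivity then removes \<open>rsh\<close> from the
    equations.\<close>
  have range: "carrier_mat n n = rsh N I ` tensors N I"
    using rsh_carrier rsh_surj by (metis (no_types) image_eqI subsetI subset_antisym image_subsetI)
  have "rshrank N I (A \<star>\<^bsub>N,I\<^esub> A) = rshrank N I A \<longleftrightarrow>
      (\<forall>S\<in>carrier_mat n n. \<forall>T\<in>carrier_mat n n. ?R * ?R * S = ?R * ?R * T \<longrightarrow> ?R * S = ?R * T)"
    using vec_space.rank_square_eq_iff_cancel[OF rsh_carrier]
    by (simp add: rshrank_eq rsh_einstein_prod)
  also have "\<dots> \<longleftrightarrow> (\<forall>S\<in>tensors N I. \<forall>T\<in>tensors N I.
      ?R * ?R * rsh N I S = ?R * ?R * rsh N I T \<longrightarrow> ?R * rsh N I S = ?R * rsh N I T)"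
    unfolding range ball_simps ..
  finally show ?thesis
    unfolding rsh_einstein_prod[symmetric] rsh_eq_iff[OF einstein_prod_closed einstein_prod_closed] .
qed

section \<open>Existence of the inverses for tensors\<close>

lemma group_inv_tensor_exists:
  assumes A: "A \<in> tensors N I" and rank: "rshrank N I (A \<star>\<^bsub>N,I\<^esub> A) = rshrank N I A"
  shows "\<exists>G. T.group_inv A G"
proof -
  have "vec_space.rank n (rsh N I A * rsh N I A) = vec_space.rank n (rsh N I A)"
    using rank by (simp add: rshrank_eq rsh_einstein_prod)
  then obtain M where "M \<in> carrier_mat n n" and M: "rsh N I A = rsh N I A * rsh N I A * M"
    using vec_space.rank_square_eq_factor[OF rsh_carrier] by blast
  then obtain Y where Y: "Y \<in> tensors N I" "rsh N I Y = M"
    using rsh_surj by blast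
  then have "rsh N I A = rsh N I (A \<star>\<^bsub>N,I\<^esub> A \<star>\<^bsub>N,I\<^esub> Y)"
    using M by (simp only: rsh_einstein_prod)
  then have "A = A \<star>\<^bsub>N,I\<^esub> A \<star>\<^bsub>N,I\<^esub> Y"
    by (simp only: rsh_eq_iff[OF A einstein_prod_closed])
  then show ?thesis
    using T.group_inv_exists[OF A Y(1)] rank unfolding rshrank_square_eq_iff_cancel by blast
qed

lemma mp_inv_tensor_exists:
  assumes A: "A \<in> tensors N I"
  shows "\<exists>X. T.mp_inv A X"
proof -
  let ?H = "conj_transpose N I A \<star>\<^bsub>N,I\<^esub> A"
  have H: "?H \<in> tensors N I" "conj_transpose N I ?H = ?H"
    using einstein_prod_closed T.star_mult[OF T.star_closed[OF A] A] unfolding T.star_star[OF A] .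
  \<comment> \<open>As \<open>?H\<close> is its own conjugate transpose, its leading factor cancels
    by orthogonality with \<open>?H\<close> in the role of \<open>A\<close>. This is the rank
    condition for \<open>?H\<close> in its cancellation form.\<close>
  have "?H \<star>\<^bsub>N,I\<^esub> S = ?H \<star>\<^bsub>N,I\<^esub> T"
    if "S \<in> tensors N I" "T \<in> tensors N I" "?H \<star>\<^bsub>N,I\<^esub> ?H \<star>\<^bsub>N,I\<^esub> S = ?H \<star>\<^bsub>N,I\<^esub> ?H \<star>\<^bsub>N,I\<^esub> T" for S T
    by (rule einstein_prod_cancel_conj_transpose)
      (use that H T.assoc[OF H(1) H(1)] in metis)
  then obtain Q where "T.group_inv ?H Q"
    using group_inv_tensor_exists[OF H(1)] unfolding rshrank_square_eq_iff_cancel by blast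
  then have "T.mp_inv A (Q \<star>\<^bsub>N,I\<^esub> conj_transpose N I A)"
  proof (rule T.mp_inv_exists[OF A])
    fix S T
    assume "S \<in> tensors N I" "T \<in> tensors N I" "?H \<star>\<^bsub>N,I\<^esub> S = ?H \<star>\<^bsub>N,I\<^esub> T"
    then have "conj_transpose N I A \<star>\<^bsub>N,I\<^esub> (A \<star>\<^bsub>N,I\<^esub> S)
        = conj_transpose N I A \<star>\<^bsub>N,I\<^esub> (A \<star>\<^bsub>N,I\<^esub> T)"
      by (metis T.assoc[OF T.star_closed[OF A] A])
    then show "A \<star>\<^bsub>N,I\<^esub> S = A \<star>\<^bsub>N,I\<^esub> T"
      by (rule einstein_prod_cancel_conj_transpose)
  qed
  then show ?thesis by blast
qed

section \<open>From definite descriptions to the abstract identities\<close>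

lemma tensor_pow_closed: "A \<in> tensors N I \<Longrightarrow> tensor_pow N I A m \<in> tensors N I"
  by (cases m) (simp_all add: einstein_prod_closed)

lemma tensor_pow_2: "A \<in> tensors N I \<Longrightarrow> tensor_pow N I A 2 = A \<star>\<^bsub>N,I\<^esub> A"
  by (simp add: numeral_2_eq_2)

lemma mp_inverse_eqI: "A \<in> tensors N I \<Longrightarrow> T.mp_inv A X \<Longrightarrow> mp_inverse N I A = X"
  unfolding mp_inverse_def T.mp_inv_def[symmetric]
  by (rule the_equality) (simp_all add: T.mp_inv_unique)

lemma group_inverse_eqI: "A \<in> tensors N I \<Longrightarrow> T.group_inv A X \<Longrightarrow> group_inverse N I A = X"
  unfolding group_inverse_def T.group_inv_def[symmetric]
  by (rule the_equality) (simp_all add: T.group_inv_unique)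

lemma core_inverse_eqI:
  assumes A: "A \<in> tensors N I" and X: "T.core_inv A X"
  shows "core_inverse N I A = X"
proof -
  \<comment> \<open>The definition uses \<open>tensor_pow\<close> with exponent 2, the locale plain
    products. They agree for members of \<open>tensors N I\<close>, so the two predicates are
    identified before uniqueness is used.\<close>
  have "core_inverse N I A = (THE X. T.core_inv A X)"
    unfolding core_inverse_def T.core_inv_def
    by (rule arg_cong[of _ _ The]) (auto simp: tensor_pow_2 A)
  also have "\<dots> = X"
    using T.core_inv_unique[OF A] X by blast
  finally show ?thesis .
qed

lemma core_tensor_identities:
  assumes core: "core_tensor N I A"
  defines "G \<equiv> group_inverse N I A" and "P \<equiv> mp_inverse N I A" and "K \<equiv> core_inverse N I A"
  shows "K = G \<star>\<^bsub>N,I\<^esub> A \<star>\<^bsub>N,I\<^esub> P"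
    and "K = G \<star>\<^bsub>N,I\<^esub> range_projector N I A"
    and "K = A \<star>\<^bsub>N,I\<^esub> G \<star>\<^bsub>N,I\<^esub> P"
    and "m \<ge> 1 \<Longrightarrow> tensor_pow N I A m \<star>\<^bsub>N,I\<^esub> K = tensor_pow N I A m \<star>\<^bsub>N,I\<^esub> P"
    and "mp_inverse N I K = tensor_pow N I A 2 \<star>\<^bsub>N,I\<^esub> P"
    and "mp_inverse N I K = tensor_pow N I A 2 \<star>\<^bsub>N,I\<^esub> K"
    and "EP_tensor N I K"
    and "core_inverse N I K = tensor_pow N I A 2 \<star>\<^bsub>N,I\<^esub> P"
    and "tensor_pow N I K 2 \<star>\<^bsub>N,I\<^esub> A = G"
    and "K \<star>\<^bsub>N,I\<^esub> A = G \<star>\<^bsub>N,I\<^esub> A"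
proof -
  have A: "A \<in> tensors N I" and "rshrank N I (A \<star>\<^bsub>N,I\<^esub> A) = rshrank N I A"
    using core by (auto simp: core_tensor_def tensor_pow_2)
  \<comment> \<open>Some group inverse exists, and uniqueness identifies it with the described one;
    only thus does \<open>G\<close> satisfy its equations. The same holds for
    \<open>P\<close>.\<close>
  then have G: "T.group_inv A G"
    using group_inv_tensor_exists group_inverse_eqI[OF A] unfolding G_def by metis
  have P: "T.mp_inv A P"
    using mp_inv_tensor_exists[OF A] mp_inverse_eqI[OF A] unfolding P_def by metis
  have closed: "G \<in> tensors N I" "P \<in> tensors N I"
    using G P by (simp_all add: T.group_inv_def T.mp_inv_def)
  note facts = A G P
  show K: "K = G \<star>\<^bsub>N,I\<^esub> A \<star>\<^bsub>N,I\<^esub> P"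
    unfolding K_def by (intro core_inverse_eqI A T.core_inv_formula facts)
  then have K_closed: "K \<in> tensors N I" by (simp add: einstein_prod_closed)
  show "K = G \<star>\<^bsub>N,I\<^esub> range_projector N I A"
    using A closed by (simp add: K range_projector_def T.assoc flip: P_def)
  show "K = A \<star>\<^bsub>N,I\<^esub> G \<star>\<^bsub>N,I\<^esub> P"
    using G by (simp add: K T.group_inv_def)
  have AK: "A \<star>\<^bsub>N,I\<^esub> K = A \<star>\<^bsub>N,I\<^esub> P"
    unfolding K by (rule T.mult_core_inv_formula[OF facts])
  show pow: "tensor_pow N I A m \<star>\<^bsub>N,I\<^esub> K = tensor_pow N I A m \<star>\<^bsub>N,I\<^esub> P" if "m \<ge> 1" for m
  proof -
    \<comment> \<open>A positive exponent leaves a factor \<open>A\<close> at the right end, where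
      \<open>A K = A P\<close> applies.\<close>
    from \<open>m \<ge> 1\<close> obtain q where "m = Suc q" by (cases m) auto
    then show ?thesis
      using A closed K_closed by (simp add: T.assoc tensor_pow_closed AK)
  qed
  show mpK: "mp_inverse N I K = tensor_pow N I A 2 \<star>\<^bsub>N,I\<^esub> P"
    using T.mp_inv_core_formula[OF facts] K_closed
    by (simp add: tensor_pow_2 A mp_inverse_eqI flip: K)
  then show "mp_inverse N I K = tensor_pow N I A 2 \<star>\<^bsub>N,I\<^esub> K"
    by (simp add: pow)
  show "EP_tensor N I K"
    using T.core_formula_commute[OF facts] K_closed
    by (simp add: EP_tensor_def mpK tensor_pow_2 A flip: K)
  show "core_inverse N I K = tensor_pow N I A 2 \<star>\<^bsub>N,I\<^esub> P"
    using T.core_inv_core_formula[OF facts] K_closed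
    by (simp add: tensor_pow_2 A core_inverse_eqI flip: K)
  show "tensor_pow N I K 2 \<star>\<^bsub>N,I\<^esub> A = G"
    using T.core_formula_square[OF facts] K_closed by (simp add: tensor_pow_2 flip: K)
  show "K \<star>\<^bsub>N,I\<^esub> A = G \<star>\<^bsub>N,I\<^esub> A"
    using T.core_formula_mult[OF facts] by (simp flip: K)
qed

end

theorem theorem3p2:
  fixes N :: nat and I :: "nat \<Rightarrow> nat" and A :: tensor
  assumes "N \<ge> 1"
    and "\<forall>k\<in>{1..N}. I k > 0"
    and "A \<in> tensors N I"
    and "core_tensor N I A"
  shows
    \<comment> \<open>(a)\<close>
    "(core_inverse N I A = group_inverse N I A \<star>\<^bsub>N,I\<^esub> A \<star>\<^bsub>N,I\<^esub> mp_inverse N I A \<and>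
      core_inverse N I A = group_inverse N I A \<star>\<^bsub>N,I\<^esub> range_projector N I A \<and>
      core_inverse N I A = A \<star>\<^bsub>N,I\<^esub> group_inverse N I A \<star>\<^bsub>N,I\<^esub> mp_inverse N I A) \<and>
    \<comment> \<open>(b)\<close>
     (\<forall>n\<ge>1. tensor_pow N I A n \<star>\<^bsub>N,I\<^esub> core_inverse N I A
           = tensor_pow N I A n \<star>\<^bsub>N,I\<^esub> mp_inverse N I A) \<and>
    \<comment> \<open>(c)\<close>
     (mp_inverse N I (core_inverse N I A) = tensor_pow N I A 2 \<star>\<^bsub>N,I\<^esub> mp_inverse N I A \<and>
      mp_inverse N I (core_inverse N I A) = tensor_pow N I A 2 \<star>\<^bsub>N,I\<^esub> core_inverse N I A) \<and>
    \<comment> \<open>(d)\<close>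
     EP_tensor N I (core_inverse N I A) \<and>
    \<comment> \<open>(e)\<close>
     core_inverse N I (core_inverse N I A) = tensor_pow N I A 2 \<star>\<^bsub>N,I\<^esub> mp_inverse N I A \<and>
    \<comment> \<open>(f)\<close>
     tensor_pow N I (core_inverse N I A) 2 \<star>\<^bsub>N,I\<^esub> A = group_inverse N I A \<and>
    \<comment> \<open>(g)\<close>
     core_inverse N I A \<star>\<^bsub>N,I\<^esub> A = group_inverse N I A \<star>\<^bsub>N,I\<^esub> A"
  using core_tensor_identities[OF assms(2,4)] by blast

end
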